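(* Let $L>0$, let $q\ge 2$, and let $\Gamma:S_L\to\mathbb{R}^n$ be an arclength parametrized closed curve (not necessarily injective). If $\mathcal{E}_q(\Gamma)<\infty$, then the image $\Gamma(S_L)$ is a one-dimensional topological manifold (possibly with boundary), embedded in $\mathbb{R}^n$.
   Context: $S_L\cong\mathbb{R}/(L\mathbb{Z})$ is the circle of perimeter $L$. An arclength parametrized closed curve of length $L$ is a Lipschitz map $\Gamma:S_L\to\mathbb{R}^n$ with $|\Gamma'|=1$ a.e.; it need not be injective. For $s\in S_L$ and almost every $t\in S_L$ (those where $\Gamma'(t)$ exists with $|\Gamma'(t)|=1$) let $\ell(t)=\{\Gamma(t)+\mu\Gamma'(t):\mu\in\mathbb{R}\}$ be the tangent line, and define the tangent-point radius $$r(\Gamma(t),\Gamma(s))=\frac{|\Gamma(t)-\Gamma(s)|^2}{2\operatorname{dist}(\ell(t),\Gamma(s))}\in[0,\infty],$$ where $r$ is set to be $0$ if $\Gamma(t)=\Gamma(s)$, and $r=\infty$ (i.e. $1/r=0$) if $\Gamma(s)-\Gamma(t)\neq0$ is parallel to $\Gamma'(t)$. The tangent-point energy is $$\mathcal{E}_q(\Gamma)=\int_0^L\int_0^L\frac{ds\,dt}{r(\Gamma(t),\Gamma(s))^q}.$$ *)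

theory Defs
  imports "HOL-Analysis.Analysis"
begin

(* Maps on the circle S_L = R/(LZ) are represented by their L-periodic lifts to the real line.
   The lift is Lipschitz iff the map on S_L is, and the image of S_L is the range of the lift. *)

definition has_unit_tangent_at :: "(real \<Rightarrow> real ^ 'n) \<Rightarrow> real \<Rightarrow> bool" where
  "has_unit_tangent_at \<Gamma> t \<longleftrightarrow>
     \<Gamma> differentiable (at t) \<and> norm (vector_derivative \<Gamma> (at t)) = 1"

definition arclength_closed_curve :: "real \<Rightarrow> (real \<Rightarrow> real ^ 'n) \<Rightarrow> bool" where
  "arclength_closed_curve L \<Gamma> \<longleftrightarrow>
     (\<forall>t. \<Gamma> (t + L) = \<Gamma> t) \<and>
     (\<exists>C. C-lipschitz_on UNIV \<Gamma>) \<and>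
     (AE t in lborel. has_unit_tangent_at \<Gamma> t)"

definition tangent_line :: "(real \<Rightarrow> real ^ 'n) \<Rightarrow> real \<Rightarrow> (real ^ 'n) set" where
  "tangent_line \<Gamma> t = {\<Gamma> t + \<mu> *\<^sub>R vector_derivative \<Gamma> (at t) | \<mu>. True}"

(* The radius r(\<Gamma>(t), \<Gamma>(s)) depends on the parameter t, not only on the point \<Gamma>(t), since \<Gamma>
   need not be injective.  It is meaningful only where has_unit_tangent_at \<Gamma> t. *)
definition tangent_point_radius :: "(real \<Rightarrow> real ^ 'n) \<Rightarrow> real \<Rightarrow> real \<Rightarrow> ennreal" where
  "tangent_point_radius \<Gamma> t s =
     (if \<Gamma> t = \<Gamma> s then 0
      else if \<exists>c. \<Gamma> s - \<Gamma> t = c *\<^sub>R vector_derivative \<Gamma> (at t) then \<infinity>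
      else ennreal ((dist (\<Gamma> t) (\<Gamma> s))\<^sup>2 / (2 * infdist (\<Gamma> s) (tangent_line \<Gamma> t))))"

(* Intended for exponents q > 0, where 0 is sent to 0 and infinity to infinity. *)
definition ennreal_powr :: "ennreal \<Rightarrow> real \<Rightarrow> ennreal" where
  "ennreal_powr x q = (if x = \<infinity> then \<infinity> else ennreal (enn2real x powr q))"

(* In ennreal, 1 / 0 is infinity and 1 / infinity is 0.  The parameters t without a unit tangent,
   for which the integrand is not defined, form a null set and are left out of the domain. *)
definition tangent_point_energy :: "real \<Rightarrow> real \<Rightarrow> (real \<Rightarrow> real ^ 'n) \<Rightarrow> ennreal" where
  "tangent_point_energy L q \<Gamma> =
     (\<integral>\<^sup>+ t \<in> {t \<in> {0..L}. has_unit_tangent_at \<Gamma> t}.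
        (\<integral>\<^sup>+ s \<in> {0..L}. 1 / ennreal_powr (tangent_point_radius \<Gamma> t s) q \<partial>lborel) \<partial>lborel)"

(* Charts take values in relatively open subsets of the half-line [0,\<infinity>); those avoiding 0 are
   the interior charts. *)
definition one_manifold_with_boundary :: "'a topology \<Rightarrow> bool" where
  "one_manifold_with_boundary X \<longleftrightarrow>
     Hausdorff_space X \<and> second_countable X \<and>
     (\<forall>x \<in> topspace X. \<exists>U V. openin X U \<and> x \<in> U \<and>
        openin (top_of_set {0::real..}) V \<and>
        subtopology X U homeomorphic_space top_of_set V)"

(* Embedded: the manifold topology is the one induced from the ambient space. *)
definition embedded_one_manifold_with_boundary :: "(real ^ 'n) set \<Rightarrow> bool" where
  "embedded_one_manifold_with_boundary M \<longleftrightarrow> one_manifold_with_boundary (top_of_set M)"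

end

theory Submission
  imports Defs
begin

text \<open>
  Finite energy makes the image \<open>M\<close> of the curve flat: there is a scale \<open>\<delta>\<close> such that for
  \<open>x \<in> M\<close> and \<open>d \<le> \<delta>\<close> the part of \<open>M\<close> in the ball of radius \<open>d\<close> around \<open>x\<close> lies in a tube of
  radius \<open>d / 64\<close> around a line through \<open>x\<close> (\<open>finite_energy_imp_flat\<close>).  Indeed, if no tangent line
  taken near \<open>x\<close> had all of \<open>M\<close> nearby in such a tube, then the radii involved would be at most of
  order \<open>d\<close> for parameters in a set of measure of order \<open>d\<^sup>2\<close>.  For \<open>q \<ge> 2\<close> this costs a fixed
  amount of energy at every scale, and absolute continuity of the integral rules that out
  at small scales.

  Flatness has one geometric consequence that is used again and again: a path in \<open>M\<close> that
  runs from one side of a point \<open>z \<in> M\<close> to the other within such a tube contains \<open>z\<close>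
  (\<open>crossing_path_contains\<close>).  For a middle part of the path runs past \<open>z\<close> at half the scale, in the
  tube of that scale; iterating, the path comes arbitrarily close to \<open>z\<close>.  The axis of the
  tube may turn from scale to scale, so the argument cannot work with a limiting direction.

  Hence an arc in \<open>M\<close> cannot fold back, because one of its branches would cross the points of the
  other one, and there is no triple junction, because an arc contains all points
  of \<open>M\<close> that it crosses.  So every arc in \<open>M\<close> without its end points is open in \<open>M\<close>
  (\<open>arc_interiors_openI\<close>).

  The rest is topology.  As the continuous image of an interval, \<open>M\<close> is path connected and locally
  path connected, and its points are joined by arcs.  A point of \<open>M\<close> in the interior of an arc has an
  open interval as a neighbourhood, and a point that is only an end point of arcs has a half-open one
  (\<open>one_manifold_if_arc_interiors_open\<close>).
\<close>

section \<open>Distance from an axis\<close>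

text \<open>
  For a unit vector \<open>e\<close> this is the distance of \<open>v\<close> from the line spanned by \<open>e\<close>.
\<close>

definition axis_deviation :: "'a::real_inner \<Rightarrow> 'a \<Rightarrow> real" where
  "axis_deviation e v = norm (v - (v \<bullet> e) *\<^sub>R e)"

lemma axis_deviation_le_norm_diff:
  assumes "norm e = 1"
  shows "axis_deviation e v \<le> norm (v - c *\<^sub>R e)"
proof -
  have ee: "e \<bullet> e = 1" using assms by (simp add: norm_eq_1)
  have "v - c *\<^sub>R e = (v - (v \<bullet> e) *\<^sub>R e) + (v \<bullet> e - c) *\<^sub>R e"
    by (simp add: algebra_simps)
  moreover have "orthogonal (v - (v \<bullet> e) *\<^sub>R e) ((v \<bullet> e - c) *\<^sub>R e)"
    by (simp add: orthogonal_def inner_diff_left ee)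
  ultimately have "(norm (v - c *\<^sub>R e))\<^sup>2
      = (axis_deviation e v)\<^sup>2 + (norm ((v \<bullet> e - c) *\<^sub>R e))\<^sup>2"
    unfolding axis_deviation_def by (metis norm_add_Pythagorean)
  then have "(axis_deviation e v)\<^sup>2 \<le> (norm (v - c *\<^sub>R e))\<^sup>2" by simp
  then show ?thesis by (rule power2_le_imp_le) simp
qed

lemma axis_deviation_le_norm: "norm e = 1 \<Longrightarrow> axis_deviation e v \<le> norm v"
  using axis_deviation_le_norm_diff[of e v 0] by simp

lemma axis_deviation_add: "axis_deviation e (v + w) \<le> axis_deviation e v + axis_deviation e w"
proof -
  have "v + w - ((v + w) \<bullet> e) *\<^sub>R e = (v - (v \<bullet> e) *\<^sub>R e) + (w - (w \<bullet> e) *\<^sub>R e)"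
    by (simp add: algebra_simps)
  then show ?thesis unfolding axis_deviation_def by (metis norm_triangle_ineq)
qed

lemma axis_deviation_minus [simp]: "axis_deviation e (- v) = axis_deviation e v"
proof -
  have "- v - ((- v) \<bullet> e) *\<^sub>R e = - (v - (v \<bullet> e) *\<^sub>R e)"
    by simp
  then show ?thesis unfolding axis_deviation_def by (metis norm_minus_cancel)
qed

lemma axis_deviation_diff: "axis_deviation e (v - w) \<le> axis_deviation e v + axis_deviation e w"
  using axis_deviation_add[of e v "- w"] by simp

lemma axis_deviation_uminus_axis [simp]: "axis_deviation (- e) v = axis_deviation e v"
  by (simp add: axis_deviation_def)

lemma norm_le_coordinate_plus_deviation:
  assumes "norm e = 1"
  shows "norm v \<le> \<bar>v \<bullet> e\<bar> + axis_deviation e v"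
  using norm_triangle_ineq[of "(v \<bullet> e) *\<^sub>R e" "v - (v \<bullet> e) *\<^sub>R e"] assms
  by (simp add: axis_deviation_def)

lemma abs_coordinate_le_norm: "norm e = 1 \<Longrightarrow> \<bar>v \<bullet> e\<bar> \<le> norm v"
  using Cauchy_Schwarz_ineq2[of v e] by simp

section \<open>First crossings of levels and spheres\<close>

lemma trim_crossing:
  fixes h :: "real \<Rightarrow> real"
  assumes cont: "continuous_on {a..b} h" and "a \<le> b" and "0 < c" and "h a \<le> - c" "c \<le> h b"
  obtains a' b' where "a \<le> a'" "a' \<le> b'" "b' \<le> b" "h a' = - c" "h b' = c"
    "\<And>t. t \<in> {a'..b'} \<Longrightarrow> \<bar>h t\<bar> \<le> c"
proof -
  \<comment> \<open>The last time at or below the lower level, and the first time after it at or above the upper one.\<close>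
  let ?S = "{a..b} \<inter> h -` {..-c}"
  have "closed ?S" by (rule continuous_closed_preimage[OF cont]) auto
  then have "compact ?S" by (metis compact_Icc compact_Int_closed inf.left_idem)
  moreover have "?S \<noteq> {}" using assms by auto
  ultimately obtain a' where a': "a' \<in> ?S" "\<And>t. t \<in> ?S \<Longrightarrow> t \<le> a'"
    using continuous_attains_sup[of ?S "\<lambda>t. t"] by (metis continuous_on_id)
  have ab': "a \<le> a'" "a' \<le> b" "h a' \<le> - c" using a'(1) by auto
  have cont': "continuous_on {a'..b} h" using ab' by (intro continuous_on_subset[OF cont]) auto
  have "\<exists>t. a' \<le> t \<and> t \<le> b \<and> h t = - c"
    by (rule IVT'[OF _ _ _ cont']) (use ab' assms in auto)
  then obtain t where t: "a' \<le> t" "t \<le> b" "h t = - c" by blast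
  then have "t = a'" using a'(2)[of t] ab' by auto
  with t have ha': "h a' = - c" by simp
  let ?T = "{a'..b} \<inter> h -` {c..}"
  have "closed ?T" by (rule continuous_closed_preimage[OF cont']) auto
  then have "compact ?T" by (metis compact_Icc compact_Int_closed inf.left_idem)
  moreover have "?T \<noteq> {}" using assms a' by auto
  ultimately obtain b' where b': "b' \<in> ?T" "\<And>t. t \<in> ?T \<Longrightarrow> b' \<le> t"
    using continuous_attains_inf[of ?T "\<lambda>t. t"] by (metis continuous_on_id)
  have "\<exists>t. a' \<le> t \<and> t \<le> b' \<and> h t = c"
    using a' b' ha' \<open>0 < c\<close> by (intro IVT') (auto intro: continuous_on_subset[OF cont'])
  with b' have hb': "h b' = c" by force
  show ?thesis
  proof (rule that[of a' b'])
    fix t assume t: "t \<in> {a'..b'}"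
    show "\<bar>h t\<bar> \<le> c"
    proof (cases "t = a' \<or> t = b'")
      case True
      then show ?thesis using ha' hb' \<open>0 < c\<close> by auto
    next
      case False
      then have "a' < t" "t < b'" using t by auto
      then have "t \<notin> ?S" "t \<notin> ?T" using a'(2)[of t] b'(2)[of t] by auto
      then show ?thesis using \<open>a' < t\<close> \<open>t < b'\<close> a'(1) b'(1) by auto
    qed
  qed (use a' b' ha' hb' in auto)
qed

lemma first_exit:
  fixes g :: "real \<Rightarrow> 'a::metric_space"
  assumes "continuous_on {a..b} g" "a \<le> b" "\<rho> \<le> dist p (g b)" "dist p (g a) \<le> \<rho>"
  obtains s where "a \<le> s" "s \<le> b" "dist p (g s) = \<rho>" "g ` {a..s} \<subseteq> cball p \<rho>"
proof -
  let ?T = "{a..b} \<inter> (\<lambda>t. dist p (g t)) -` {\<rho>..}"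
  have cont: "continuous_on {a..b} (\<lambda>t. dist p (g t))" by (intro continuous_intros assms)
  have "closed ?T" by (rule continuous_closed_preimage[OF cont]) auto
  then have "compact ?T" by (metis compact_Icc compact_Int_closed inf.left_idem)
  moreover have "?T \<noteq> {}" using assms by auto
  ultimately obtain s where s: "s \<in> ?T" "\<And>t. t \<in> ?T \<Longrightarrow> s \<le> t"
    using continuous_attains_inf[of ?T "\<lambda>t. t"] by (metis continuous_on_id)
  have sab: "a \<le> s" "s \<le> b" "\<rho> \<le> dist p (g s)" using s(1) by auto
  have "continuous_on {a..s} (\<lambda>t. dist p (g t))"
    using sab by (intro continuous_on_subset[OF cont]) auto
  then have "\<exists>t. a \<le> t \<and> t \<le> s \<and> dist p (g t) = \<rho>"
    by (intro IVT') (use sab assms in auto)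
  with s have eq: "dist p (g s) = \<rho>" by force
  have "dist p (g t) \<le> \<rho>" if "t \<in> {a..s}" for t
    using s(2)[of t] that s(1) eq by (cases "t = s"; force)
  with s eq show thesis by (intro that[of s]) auto
qed

lemma last_entry:
  fixes g :: "real \<Rightarrow> 'a::metric_space"
  assumes "continuous_on {a..b} g" "a \<le> b" "\<rho> \<le> dist p (g a)" "dist p (g b) \<le> \<rho>"
  obtains s where "a \<le> s" "s \<le> b" "dist p (g s) = \<rho>" "g ` {s..b} \<subseteq> cball p \<rho>"
proof -
  have c: "continuous_on {-b..-a} (\<lambda>t. g (- t))"
    by (rule continuous_on_compose2[OF assms(1)]) (auto intro: continuous_intros)
  obtain s where s: "-b \<le> s" "s \<le> -a" "dist p (g (- s)) = \<rho>" "(\<lambda>t. g (- t)) ` {-b..s} \<subseteq> cball p \<rho>"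
    by (rule first_exit[OF c, of \<rho> p]) (use assms in auto)
  have "g t \<in> cball p \<rho>" if "t \<in> {-s..b}" for t
    using s(4) that by (auto simp: image_subset_iff dest: bspec[of _ _ "- t"])
  with s show thesis by (intro that[of "- s"]) auto
qed

section \<open>Paths crossing a point of a flat set\<close>

text \<open>
  A one-sided Reifenberg condition: the set stays close to a line, but nothing forces it to come
  close to every point of that line, so end points and gaps are permitted.  The constant
  \<open>1 / 64\<close> leaves room for moving the centre of a ball from \<open>x\<close> to another point of
  the set and for halving its radius, which together cost a factor \<open>4\<close> against the tolerance
  \<open>1 / 16\<close> of the crossing paths below.
\<close>

definition flat_at :: "'a::real_inner set \<Rightarrow> 'a \<Rightarrow> real \<Rightarrow> 'a \<Rightarrow> bool" where
  "flat_at M x d e \<longleftrightarrow>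
     norm e = 1 \<and> (\<forall>w \<in> M \<inter> cball x d. axis_deviation e (w - x) \<le> d / 64)"

definition flat_below_scale :: "'a::real_inner set \<Rightarrow> real \<Rightarrow> bool" where
  "flat_below_scale M \<delta> \<longleftrightarrow> (\<forall>x \<in> M. \<forall>d. 0 < d \<and> d \<le> \<delta> \<longrightarrow> (\<exists>e. flat_at M x d e))"

text \<open>
  The path goes from one side of \<open>z\<close> to the other at scale \<open>\<rho>\<close>, staying close to the line
  through \<open>z\<close> in direction \<open>e\<close>.  The direction is quantified for each scale anew, since it may
  keep turning as \<open>\<rho>\<close> decreases: a flat set can be a slow spiral, without a tangent at \<open>z\<close>.
\<close>

definition passes :: "(real \<Rightarrow> 'a::real_inner) \<Rightarrow> real \<Rightarrow> real \<Rightarrow> 'a \<Rightarrow> real \<Rightarrow> bool" where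
  "passes g a b z \<rho> \<longleftrightarrow>
     (\<exists>a' b' e. a \<le> a' \<and> a' \<le> b' \<and> b' \<le> b \<and> norm e = 1 \<and>
        (\<forall>t \<in> {a'..b'}. axis_deviation e (g t - z) \<le> \<rho> / 16) \<and>
        (g a' - z) \<bullet> e \<le> - \<rho> / 4 \<and> \<rho> / 4 \<le> (g b' - z) \<bullet> e)"

text \<open>
  The part of the path with coordinates between \<open>- \<rho> / 4\<close> and \<open>\<rho> / 4\<close> lies in the ball of
  radius \<open>\<rho> / 2\<close> around \<open>z\<close>, where flatness supplies a new axis \<open>e'\<close>.  The end points of
  this part have distance at least \<open>\<rho> / 4\<close> from \<open>z\<close>, so they are far out along \<open>e'\<close> too; as
  they are almost opposite with respect to \<open>z\<close>, they lie on different sides also along \<open>e'\<close>.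
\<close>

lemma passes_half:
  assumes p: "passes g a b z \<rho>" and cont: "continuous_on {a..b} g" and gM: "g ` {a..b} \<subseteq> M"
    and flat: "flat_at M z (\<rho> / 2) e'" and "0 < \<rho>"
  shows "passes g a b z (\<rho> / 2)"
proof -
  obtain a0 b0 e where ab0: "a \<le> a0" "a0 \<le> b0" "b0 \<le> b" and e: "norm e = 1"
    and dev: "\<And>t. t \<in> {a0..b0} \<Longrightarrow> axis_deviation e (g t - z) \<le> \<rho> / 16"
    and ends: "(g a0 - z) \<bullet> e \<le> - \<rho> / 4" "\<rho> / 4 \<le> (g b0 - z) \<bullet> e"
    using p unfolding passes_def by blast
  have c0: "continuous_on {a0..b0} (\<lambda>t. (g t - z) \<bullet> e)"
    using ab0 by (intro continuous_intros continuous_on_subset[OF cont]) auto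
  obtain a1 b1 where ab1: "a0 \<le> a1" "a1 \<le> b1" "b1 \<le> b0"
    and ends1: "(g a1 - z) \<bullet> e = - (\<rho> / 4)" "(g b1 - z) \<bullet> e = \<rho> / 4"
    and mid: "\<And>t. t \<in> {a1..b1} \<Longrightarrow> \<bar>(g t - z) \<bullet> e\<bar> \<le> \<rho> / 4"
    using trim_crossing[OF c0, of "\<rho> / 4"] ab0 ends \<open>0 < \<rho>\<close> by (smt (verit) minus_divide_left divide_pos_pos)
  have e': "norm e' = 1"
    and flat': "\<And>w. w \<in> M \<Longrightarrow> norm (w - z) \<le> \<rho> / 2 \<Longrightarrow> axis_deviation e' (w - z) \<le> \<rho> / 128"
    using flat unfolding flat_at_def by (auto simp: dist_norm norm_minus_commute)
  have dev': "axis_deviation e' (g t - z) \<le> \<rho> / 128" if t: "t \<in> {a1..b1}" for t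
  proof (rule flat')
    show "g t \<in> M" using t ab0 ab1 gM by auto
    have "axis_deviation e (g t - z) \<le> \<rho> / 16" using dev t ab1 by auto
    then show "norm (g t - z) \<le> \<rho> / 2"
      using norm_le_coordinate_plus_deviation[OF e, of "g t - z"] mid[OF t] \<open>0 < \<rho>\<close> by linarith
  qed
  have large: "\<rho> / 8 + \<rho> / 16 \<le> \<bar>(g t - z) \<bullet> e'\<bar>" if "t \<in> {a1..b1}" "\<bar>(g t - z) \<bullet> e\<bar> = \<rho> / 4" for t
    using abs_coordinate_le_norm[OF e, of "g t - z"] that
      norm_le_coordinate_plus_deviation[OF e', of "g t - z"] dev'[OF that(1)] \<open>0 < \<rho>\<close> by linarith
  let ?u = "g a1 - z" and ?v = "g b1 - z"
  have "norm (?u + ?v) \<le> \<bar>(?u + ?v) \<bullet> e\<bar> + (axis_deviation e ?u + axis_deviation e ?v)"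
    using norm_le_coordinate_plus_deviation[OF e, of "?u + ?v"] axis_deviation_add[of e ?u ?v] by linarith
  also have "\<dots> \<le> \<rho> / 8"
    using ends1 dev[of a1] dev[of b1] ab1 by (simp add: inner_add_left)
  finally have "\<bar>(?u + ?v) \<bullet> e'\<bar> \<le> \<rho> / 8"
    using abs_coordinate_le_norm[OF e', of "?u + ?v"] by linarith
  then have sum: "\<bar>?u \<bullet> e' + ?v \<bullet> e'\<bar> \<le> \<rho> / 8" by (simp add: inner_add_left)
  have la: "\<rho> / 8 + \<rho> / 16 \<le> \<bar>?u \<bullet> e'\<bar>" and lb: "\<rho> / 8 + \<rho> / 16 \<le> \<bar>?v \<bullet> e'\<bar>"
    using large ab1 ends1 \<open>0 < \<rho>\<close> by auto
  \<comment> \<open>The reversed axis is just as good, and one of the two orientations has the end of the path on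
    its positive side.\<close>
  define f where "f = (if ?v \<bullet> e' > 0 then e' else - e')"
  have "?v \<bullet> f \<ge> \<rho> / 8" "?u \<bullet> f \<le> - \<rho> / 8"
    using sum la lb \<open>0 < \<rho>\<close> unfolding f_def by (auto simp: abs_if split: if_splits)
  moreover have "norm f = 1" "\<And>t. t \<in> {a1..b1} \<Longrightarrow> axis_deviation f (g t - z) \<le> \<rho> / 32"
    using e' dev' \<open>0 < \<rho>\<close> unfolding f_def by (force split: if_splits)+
  ultimately show ?thesis
    unfolding passes_def using ab0 ab1
    by (intro exI[of _ a1] exI[of _ b1] exI[of _ f]) auto
qed

lemma passes_imp_near:
  assumes p: "passes g a b z \<rho>" and cont: "continuous_on {a..b} g" and "0 < \<rho>"
  obtains t where "t \<in> {a..b}" "norm (g t - z) \<le> \<rho> / 16"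
proof -
  obtain a0 b0 e where ab0: "a \<le> a0" "a0 \<le> b0" "b0 \<le> b" and e: "norm e = 1"
    and dev: "\<And>t. t \<in> {a0..b0} \<Longrightarrow> axis_deviation e (g t - z) \<le> \<rho> / 16"
    and ends: "(g a0 - z) \<bullet> e \<le> - \<rho> / 4" "\<rho> / 4 \<le> (g b0 - z) \<bullet> e"
    using p unfolding passes_def by blast
  have c0: "continuous_on {a0..b0} (\<lambda>t. (g t - z) \<bullet> e)"
    using ab0 by (intro continuous_intros continuous_on_subset[OF cont]) auto
  have "\<exists>t. a0 \<le> t \<and> t \<le> b0 \<and> (g t - z) \<bullet> e = 0"
    using c0 ends ab0 \<open>0 < \<rho>\<close> by (intro IVT') auto
  then obtain t where "t \<in> {a0..b0}" "(g t - z) \<bullet> e = 0" by auto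
  then show thesis
    using that[of t] dev[of t] norm_le_coordinate_plus_deviation[OF e, of "g t - z"] ab0 by auto
qed

text \<open>
  This is what excludes a second strand beside a crossing path.  Passing \<open>z\<close> at one scale entails
  passing it at all smaller scales, hence coming arbitrarily close to \<open>z\<close>; and the image of the
  path is compact.
\<close>

lemma passes_imp_mem:
  assumes p: "passes g a b z \<rho>" and cont: "continuous_on {a..b} g" and gM: "g ` {a..b} \<subseteq> M"
    and flat: "flat_below_scale M \<delta>" and "0 < \<rho>" "\<rho> \<le> \<delta>" and "z \<in> M"
  shows "z \<in> g ` {a..b}"
proof -
  have all: "passes g a b z (\<rho> / 2 ^ k)" for k
  proof (induction k)
    case (Suc k)
    have "\<rho> / 2 ^ k / 2 \<le> \<rho> / 1"
      using \<open>0 < \<rho>\<close> unfolding divide_divide_eq_left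
      by (intro divide_left_mono) (auto simp: one_le_power intro: order_trans[OF _ mult_right_mono[of 1 "2 ^ k" "2::real"]])
    then obtain e where "flat_at M z (\<rho> / 2 ^ k / 2) e"
      using flat \<open>z \<in> M\<close> \<open>0 < \<rho>\<close> \<open>\<rho> \<le> \<delta>\<close> unfolding flat_below_scale_def
      by (metis div_by_1 divide_pos_pos order_trans zero_less_numeral zero_less_power)
    from passes_half[OF Suc cont gM this] \<open>0 < \<rho>\<close> show ?case by (simp add: field_simps)
  qed (use p in simp)
  have "z \<in> closure (g ` {a..b})"
  proof (rule closure_approachable[THEN iffD2], intro allI impI)
    fix r :: real assume "0 < r"
    obtain k where "\<rho> / r < 2 ^ k" using real_arch_pow[of 2 "\<rho> / r"] by auto
    then have k: "\<rho> / 2 ^ k < r" using \<open>0 < r\<close> by (simp add: field_simps)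
    obtain t where "t \<in> {a..b}" "norm (g t - z) \<le> \<rho> / 2 ^ k / 16"
      using passes_imp_near[OF all[of k] cont] \<open>0 < \<rho>\<close> by (metis divide_pos_pos zero_less_numeral zero_less_power)
    moreover have "\<rho> / 2 ^ k / 16 \<le> \<rho> / 2 ^ k"
      using \<open>0 < \<rho>\<close> divide_left_mono[of 1 16 "\<rho> / 2 ^ k"] by simp
    ultimately show "\<exists>y \<in> g ` {a..b}. dist y z < r"
      using k by (force simp: dist_norm)
  qed
  moreover have "closed (g ` {a..b})"
    using cont by (intro compact_imp_closed compact_continuous_image) auto
  ultimately show ?thesis by simp
qed

text \<open>
  The form in which the previous lemma is applied: the axis belongs to a ball around some other
  point \<open>p\<close>.  Relative to \<open>z\<close> the deviation doubles to \<open>\<rho> / 32\<close>, which is the tolerance for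
  passing \<open>z\<close> at scale \<open>\<rho> / 2\<close>.
\<close>

lemma crossing_path_contains:
  fixes g :: "real \<Rightarrow> 'a::real_inner"
  assumes flat: "flat_below_scale M \<delta>" and at: "flat_at M p \<rho> e"
    and \<rho>: "0 < \<rho>" "\<rho> \<le> \<delta>" and "a \<le> b" and cont: "continuous_on {a..b} g"
    and gM: "g ` {a..b} \<subseteq> M \<inter> cball p \<rho>" and z: "z \<in> M \<inter> cball p \<rho>"
    and ends: "(g a - z) \<bullet> e \<le> - \<rho> / 8" "\<rho> / 8 \<le> (g b - z) \<bullet> e"
  shows "z \<in> g ` {a..b}"
proof (rule passes_imp_mem[where \<rho> = "\<rho> / 2"])
  have dev: "axis_deviation e (w - z) \<le> \<rho> / 32" if "w \<in> M \<inter> cball p \<rho>" for w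
  proof -
    have "axis_deviation e (w - p) \<le> \<rho> / 64" "axis_deviation e (z - p) \<le> \<rho> / 64"
      using at that z unfolding flat_at_def by auto
    then show ?thesis using axis_deviation_diff[of e "w - p" "z - p"] by simp
  qed
  show "passes g a b z (\<rho> / 2)"
    unfolding passes_def using \<open>a \<le> b\<close> ends at dev gM
    by (intro exI[of _ a] exI[of _ b] exI[of _ e]) (auto simp: flat_at_def image_subset_iff)
qed (use \<rho> gM z cont flat in auto)

section \<open>Arcs in flat sets\<close>

text \<open>
  An arc in a flat set cannot fold back.  If both branches at \<open>g \<tau>\<close> ran to the same side, then
  a point of the first branch halfway out would be crossed by the second one, and so lie on it.
\<close>

lemma same_side_branches_meet:
  fixes g :: "real \<Rightarrow> 'a::real_inner"
  assumes flat: "flat_below_scale M \<delta>" and at: "flat_at M (g \<tau>) \<rho> e"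
    and \<rho>: "0 < \<rho>" "\<rho> \<le> \<delta>" and st: "s1 \<le> \<tau>" "\<tau> \<le> s2"
    and cont: "continuous_on {s1..s2} g" and gM: "g ` {s1..s2} \<subseteq> M \<inter> cball (g \<tau>) \<rho>"
    and far: "3 / 4 * \<rho> \<le> (g s1 - g \<tau>) \<bullet> e" "3 / 4 * \<rho> \<le> (g s2 - g \<tau>) \<bullet> e"
  shows "\<not> inj_on g {s1..s2}"
proof
  assume inj: "inj_on g {s1..s2}"
  have "continuous_on {s1..\<tau>} (\<lambda>t. (g t - g \<tau>) \<bullet> e)"
    using st by (intro continuous_intros continuous_on_subset[OF cont]) auto
  then have "\<exists>t. s1 \<le> t \<and> t \<le> \<tau> \<and> (g t - g \<tau>) \<bullet> e = \<rho> / 2"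
    using far st \<rho> by (intro IVT2') auto
  then obtain t where t: "s1 \<le> t" "t \<le> \<tau>" "(g t - g \<tau>) \<bullet> e = \<rho> / 2" by blast
  have "g t \<in> g ` {\<tau>..s2}"
  proof (rule crossing_path_contains[OF flat at \<rho>])
    have "(g \<tau> - g t) \<bullet> e = - (\<rho> / 2)" using t(3) by (simp add: inner_diff_left)
    then show "(g \<tau> - g t) \<bullet> e \<le> - \<rho> / 8" using \<rho> by simp
    have "(g s2 - g t) \<bullet> e = (g s2 - g \<tau>) \<bullet> e - \<rho> / 2"
      using t(3) by (simp add: inner_diff_left)
    then show "\<rho> / 8 \<le> (g s2 - g t) \<bullet> e" using far \<rho> by linarith
    show "continuous_on {\<tau>..s2} g" using st by (intro continuous_on_subset[OF cont]) auto
  qed (use st t gM in \<open>auto simp: image_subset_iff\<close>)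
  then obtain t' where "t' \<in> {\<tau>..s2}" "g t = g t'" by auto
  then have "t = t'" using inj t st by (auto simp: inj_on_def)
  then have "t = \<tau>" using t \<open>t' \<in> _\<close> by auto
  then show False using t(3) \<rho> by simp
qed

text \<open>
  Arcs in a flat set have no branching points.  Follow the arc from \<open>g \<tau>\<close> in both directions
  until it leaves a small ball.  It does not fold, so it leaves on opposite sides, and therefore
  crosses every point of the set near \<open>g \<tau>\<close>.
\<close>

lemma interior_point_of_arc_nbhd:
  assumes flat: "flat_below_scale M \<delta>" and "0 < \<delta>" and "arc g" and gM: "path_image g \<subseteq> M"
    and \<tau>: "0 < \<tau>" "\<tau> < 1"
  obtains r where "0 < r" "M \<inter> ball (g \<tau>) r \<subseteq> g ` {0<..<1}"
proof -
  have cont: "continuous_on {0..1} g" and inj: "inj_on g {0..1}"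
    using \<open>arc g\<close> by (auto simp: arc_def path_def)
  let ?p = "g \<tau>"
  have ne: "?p \<noteq> g 0" "?p \<noteq> g 1" using inj \<tau> by (auto dest!: inj_onD[OF inj])
  define \<rho> where "\<rho> = Min {\<delta>, dist ?p (g 0), dist ?p (g 1)}"
  have \<rho>: "0 < \<rho>" "\<rho> \<le> \<delta>" "\<rho> \<le> dist ?p (g 0)" "\<rho> \<le> dist ?p (g 1)"
    using ne \<open>0 < \<delta>\<close> by (auto simp: \<rho>_def)
  obtain s1 where s1: "0 \<le> s1" "s1 \<le> \<tau>" "dist ?p (g s1) = \<rho>" "g ` {s1..\<tau>} \<subseteq> cball ?p \<rho>"
    using last_entry[of 0 \<tau> g \<rho> ?p] \<rho> \<tau> continuous_on_subset[OF cont, of "{0..\<tau>}"] by auto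
  obtain s2 where s2: "\<tau> \<le> s2" "s2 \<le> 1" "dist ?p (g s2) = \<rho>" "g ` {\<tau>..s2} \<subseteq> cball ?p \<rho>"
    using first_exit[of \<tau> 1 g \<rho> ?p] \<rho> \<tau> continuous_on_subset[OF cont, of "{\<tau>..1}"] by auto
  have cont12: "continuous_on {s1..s2} g" using s1 s2 by (intro continuous_on_subset[OF cont]) auto
  have inj12: "inj_on g {s1..s2}" using s1 s2 by (intro inj_on_subset[OF inj]) auto
  have "g t \<in> M \<inter> cball ?p \<rho>" if "t \<in> {s1..s2}" for t
  proof
    show "g t \<in> M" using that s1 s2 gM by (auto simp: path_image_def)
    show "g t \<in> cball ?p \<rho>" using that s1(4) s2(4) by (cases "t \<le> \<tau>") (auto simp: image_subset_iff)
  qed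
  then have gM12: "g ` {s1..s2} \<subseteq> M \<inter> cball ?p \<rho>" by blast
  have pM: "?p \<in> M" using gM \<tau> by (auto simp: path_image_def)
  obtain e0 where e0: "flat_at M ?p \<rho> e0"
    using flat pM \<rho> unfolding flat_below_scale_def by blast
  have neg: "flat_at M x d (- e)" if "flat_at M x d e" for x d e
    using that by (simp add: flat_at_def)
  \<comment> \<open>The axis is oriented so that the second branch leaves on its positive side.\<close>
  define e where "e = (if (g s2 - ?p) \<bullet> e0 > 0 then e0 else - e0)"
  have e: "flat_at M ?p \<rho> e" using e0 neg by (simp add: e_def)
  have big: "3 / 4 * \<rho> \<le> \<bar>(g s - ?p) \<bullet> e\<bar>" if "s \<in> {s1..s2}" "dist ?p (g s) = \<rho>" for s
  proof -
    have "g s \<in> M \<inter> cball ?p \<rho>" using gM12 that by blast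
    then have "axis_deviation e (g s - ?p) \<le> \<rho> / 64" using e unfolding flat_at_def by blast
    moreover have "norm (g s - ?p) = \<rho>" using that by (simp add: dist_norm norm_minus_commute)
    ultimately show ?thesis
      using norm_le_coordinate_plus_deviation[of e "g s - ?p"] e \<rho>(1) by (auto simp: flat_at_def)
  qed
  have b1: "3 / 4 * \<rho> \<le> \<bar>(g s1 - ?p) \<bullet> e\<bar>" and b2: "3 / 4 * \<rho> \<le> (g s2 - ?p) \<bullet> e"
    using big[of s1] big[of s2] s1 s2 by (auto simp: e_def split: if_splits)
  then have opp: "(g s1 - ?p) \<bullet> e \<le> - (3 / 4 * \<rho>)"
    using same_side_branches_meet[OF flat e \<rho>(1,2) s1(2) s2(1) cont12 gM12] inj12 by linarith
  have "M \<inter> ball ?p (\<rho> / 8) \<subseteq> g ` {0<..<1}"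
  proof
    fix z assume z: "z \<in> M \<inter> ball ?p (\<rho> / 8)"
    have "\<bar>(z - ?p) \<bullet> e\<bar> \<le> norm (z - ?p)"
      using e by (intro abs_coordinate_le_norm) (simp add: flat_at_def)
    also have "\<dots> \<le> \<rho> / 8" using z by (simp add: dist_norm norm_minus_commute)
    finally have ze: "\<bar>(z - ?p) \<bullet> e\<bar> \<le> \<rho> / 8" .
    have eq: "(g s - z) \<bullet> e = (g s - ?p) \<bullet> e - (z - ?p) \<bullet> e" for s by (simp add: inner_diff_left)
    have "z \<in> g ` {s1..s2}"
    proof (rule crossing_path_contains[OF flat e \<rho>(1,2) _ cont12 gM12])
      show "(g s1 - z) \<bullet> e \<le> - \<rho> / 8" "\<rho> / 8 \<le> (g s2 - z) \<bullet> e"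
        using eq[of s1] eq[of s2] ze opp b2 \<rho>(1) by linarith+
    qed (use s1 s2 z \<rho> in auto)
    then obtain t where t: "t \<in> {s1..s2}" "z = g t" by blast
    have "z \<noteq> g 0" "z \<noteq> g 1" using z \<rho> by auto
    then have "t \<noteq> 0" "t \<noteq> 1" using t by auto
    then show "z \<in> g ` {0<..<1}" using t s1 s2 by auto
  qed
  then show thesis using that[of "\<rho> / 8"] \<rho> by auto
qed

text \<open>
  What the topological part of the argument uses of the geometry.
\<close>

definition arc_interiors_open :: "'a::euclidean_space set \<Rightarrow> bool" where
  "arc_interiors_open M \<longleftrightarrow>
     (\<forall>g. arc g \<and> path_image g \<subseteq> M \<longrightarrow> openin (top_of_set M) (g ` {0<..<1}))"

lemma arc_interiors_openI:
  fixes M :: "'a::euclidean_space set"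
  assumes flat: "flat_below_scale M \<delta>" and "0 < \<delta>"
  shows "arc_interiors_open M"
  unfolding arc_interiors_open_def
proof (intro allI impI, elim conjE)
  fix g :: "real \<Rightarrow> 'a" assume g: "arc g" "path_image g \<subseteq> M"
  show "openin (top_of_set M) (g ` {0<..<1})"
    unfolding openin_euclidean_subtopology_iff
  proof (intro conjI ballI)
    show "g ` {0<..<1} \<subseteq> M" using g by (auto simp: path_image_def)
    fix y assume "y \<in> g ` {0<..<1}"
    then obtain \<tau> where \<tau>: "0 < \<tau>" "\<tau> < 1" "y = g \<tau>" by auto
    obtain r where "0 < r" "M \<inter> ball (g \<tau>) r \<subseteq> g ` {0<..<1}"
      using interior_point_of_arc_nbhd[OF flat \<open>0 < \<delta>\<close> g \<tau>(1,2)] .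
    then show "\<exists>e>0. \<forall>x'\<in>M. dist x' y < e \<longrightarrow> x' \<in> g ` {0<..<1}"
      using \<tau>(3) by (intro exI[of _ r]) (auto simp: dist_commute)
  qed
qed

section \<open>One-manifolds from open arcs\<close>

lemma one_manifold_with_boundary_top_of_set:
  fixes M :: "'a::euclidean_space set"
  assumes "\<And>x. x \<in> M \<Longrightarrow> \<exists>U V. openin (top_of_set M) U \<and> x \<in> U \<and>
             openin (top_of_set {0::real..}) V \<and> U homeomorphic V"
  shows "one_manifold_with_boundary (top_of_set M)"
  unfolding one_manifold_with_boundary_def
proof (intro conjI ballI)
  show "Hausdorff_space (top_of_set M)"
    by (simp add: Hausdorff_space_subtopology)
  show "second_countable (top_of_set M)"
  proof (rule second_countable_subtopology)
    obtain B :: "'a set set" where "countable B" and B: "topological_basis B"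
      using ex_countable_basis by blast
    then show "second_countable (euclidean :: 'a topology)"
      unfolding second_countable_def
      by (intro exI[of _ B]) (auto simp: topological_basis_open elim: topological_basisE[OF B])
  qed
next
  fix x assume "x \<in> topspace (top_of_set M)"
  then have "x \<in> M" by simp
  then obtain U V where UV: "openin (top_of_set M) U" "x \<in> U"
      "openin (top_of_set {0::real..}) V" "U homeomorphic V"
    using assms by blast
  have "subtopology (top_of_set M) U = top_of_set U"
    using UV(1) by (simp add: subtopology_subtopology inf.absorb2 openin_imp_subset)
  moreover have "top_of_set U homeomorphic_space top_of_set V"
  proof -
    obtain f f' where "homeomorphism U V f f'" using UV(4) unfolding homeomorphic_def by blast
    then have "homeomorphic_maps (top_of_set U) (top_of_set V) f f'"
      by (auto simp: homeomorphic_maps_def homeomorphism_def continuous_map_in_subtopology)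
    then show ?thesis by (auto simp: homeomorphic_space_def)
  qed
  ultimately show "\<exists>U V. openin (top_of_set M) U \<and> x \<in> U \<and>
      openin (top_of_set {0::real..}) V \<and>
      subtopology (top_of_set M) U homeomorphic_space top_of_set V"
    using UV by (intro exI[of _ U] exI[of _ V]) simp
qed

lemma arc_image_homeomorphic:
  fixes g :: "real \<Rightarrow> 'a::t2_space"
  assumes "arc g" "T \<subseteq> {0..1}"
  shows "g ` T homeomorphic T"
proof -
  obtain h where "homeomorphism {0..1} (path_image g) g h"
    using homeomorphism_arc[OF \<open>arc g\<close>] by blast
  then have "homeomorphism T (g ` T) g h"
    by (rule homeomorphism_of_subsets) (use assms in \<open>auto simp: path_image_def\<close>)
  then show ?thesis by (metis homeomorphic_def homeomorphic_sym)
qed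

lemma locally_path_connected_compact_image:
  fixes f :: "real \<Rightarrow> 'a::t2_space"
  assumes "continuous_on {a..b} f"
  shows "locally path_connected (f ` {a..b})"
proof (rule locally_path_connected_quotient_image)
  show "locally path_connected {a..b}" by (simp add: convex_imp_locally_path_connected)
  fix T assume "T \<subseteq> f ` {a..b}"
  then show "openin (top_of_set {a..b}) ({a..b} \<inter> f -` T) \<longleftrightarrow> openin (top_of_set (f ` {a..b})) T"
    by (rule Abstract_Topology_2.continuous_imp_quotient_map[OF assms refl compact_Icc])
qed

text \<open>
  If points of \<open>M\<close> outside the arc accumulated at its end point \<open>g 0\<close>, one of them could be joined to
  \<open>g 0\<close> by a short arc \<open>h\<close> in \<open>M\<close>.  Apart from \<open>g 0\<close>, the image of \<open>h\<close> is connected and covered by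
  the disjoint open sets \<open>g ` {0<..<1}\<close> and \<open>M - path_image g\<close>; as \<open>h\<close> ends in the latter, it meets
  \<open>g\<close> only in \<open>g 0\<close>.  Then \<open>g\<close> and \<open>h\<close> form an arc with \<open>g 0\<close> in its interior.
\<close>

lemma arc_end_nbhd:
  fixes M :: "'a::euclidean_space set"
  assumes arcs: "arc_interiors_open M" and lpc: "locally path_connected M"
    and g: "arc g" "path_image g \<subseteq> M"
    and not_inner: "\<And>h \<tau>. arc h \<Longrightarrow> path_image h \<subseteq> M \<Longrightarrow> 0 < \<tau> \<Longrightarrow> \<tau> < 1 \<Longrightarrow> h \<tau> \<noteq> g 0"
  shows "openin (top_of_set M) (g ` {0..<1})"
proof -
  have inj: "inj_on g {0..1}" and gc: "continuous_on {0..1} g"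
    using g by (auto simp: arc_def path_def)
  define x where "x = g 0"
  have "x \<noteq> g 1" using inj by (auto simp: x_def dest: inj_onD[OF inj])
  have xM: "x \<in> M" using g by (auto simp: x_def path_image_def)
  have open_in: "openin (top_of_set M) (g ` {0<..<1})"
    using arcs g unfolding arc_interiors_open_def by blast
  have "openin (top_of_set M) (M - {g 1})"
    by (simp add: openin_delete)
  then obtain W V where W: "openin (top_of_set M) W" "path_connected V" "x \<in> W" "W \<subseteq> V" "V \<subseteq> M - {g 1}"
    using locallyE[OF lpc, of "M - {g 1}" x] xM \<open>x \<noteq> g 1\<close> by blast
  have "V \<subseteq> g ` {0..<1}"
  proof (rule ccontr)
    assume "\<not> V \<subseteq> g ` {0..<1}"
    then obtain z where z: "z \<in> V" "z \<notin> g ` {0..<1}" by blast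
    have "{0..<1} \<union> {1::real} = {0..1}" by auto
    then have pg: "path_image g = insert (g 1) (g ` {0..<1})"
      unfolding path_image_def by (metis Un_insert_right image_insert sup_bot_right)
    have zA: "z \<notin> path_image g" using z W pg by blast
    have "x \<noteq> z" using zA by (auto simp: x_def path_image_def)
    moreover have "x \<in> V" using W by blast
    ultimately obtain h where h: "arc h" "path_image h \<subseteq> V" "h 0 = x" "h 1 = z"
      using W(2) z(1) unfolding path_connected_arcwise pathstart_def pathfinish_def by blast
    have hinj: "inj_on h {0..1}" and hc: "continuous_on {0..1} h"
      using h by (auto simp: arc_def path_def)
    let ?H = "h ` {0<..1}" and ?I = "g ` {0<..<1}" and ?O = "M - path_image g"
    have conn: "connected ?H"
      by (intro connected_continuous_image continuous_on_subset[OF hc]) auto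
    have "h t \<noteq> x" if "t \<in> {0<..1}" for t
      using that h(3) inj_onD[OF hinj, of t 0] by auto
    moreover have "?H \<subseteq> V" using h(2) by (auto simp: path_image_def)
    ultimately have hM: "?H \<subseteq> M - {x} - {g 1}" using W by blast
    have "{0..1} = insert 0 (insert 1 {0<..<1::real})" by auto
    then have pgx: "path_image g = insert x (insert (g 1) ?I)"
      unfolding path_image_def x_def by (metis image_insert)
    have restrict: "openin (top_of_set ?H) (?H \<inter> S)" if S: "openin (top_of_set M) S" for S
    proof -
      obtain T where "open T" "S = M \<inter> T" using S unfolding openin_open by blast
      moreover from this hM have "?H \<inter> S = ?H \<inter> T" by blast
      ultimately show ?thesis by (metis openin_open_Int)
    qed
    have "open (- path_image g)" using closed_arc_image[OF g(1)] by (rule open_Compl)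
    then have "openin (top_of_set M) ?O" unfolding Diff_eq by (rule openin_open_Int)
    then have "openin (top_of_set ?H) (?H \<inter> ?O)" "openin (top_of_set ?H) (?H \<inter> ?I)"
      using open_in by (blast intro: restrict)+
    moreover have "?H \<subseteq> (?H \<inter> ?O) \<union> (?H \<inter> ?I)" using hM pgx by blast
    moreover have "(?H \<inter> ?O) \<inter> (?H \<inter> ?I) = {}" using pgx by blast
    ultimately have "?H \<inter> ?O = {} \<or> ?H \<inter> ?I = {}"
      using conn unfolding connected_openin by blast
    moreover have "h 1 \<in> ?H" by (rule imageI) simp
    then have "?H \<inter> ?O \<noteq> {}" using zA h(4) W z by blast
    ultimately have "?H \<inter> ?I = {}" by blast
    with pgx hM have disj: "h ` {0<..1} \<inter> path_image g = {}" by blast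
    have "{0..1} = insert 0 {0<..1::real}" by auto
    then have ph: "path_image h = insert x (h ` {0<..1})"
      unfolding path_image_def using h(3) by (metis image_insert)
    have "arc (reversepath g +++ h)"
    proof (rule arc_join)
      show "arc (reversepath g)" "arc h" using g h by (auto simp: arc_reversepath)
      show "pathfinish (reversepath g) = pathstart h" using h by (simp add: x_def pathstart_def)
      show "path_image (reversepath g) \<inter> path_image h \<subseteq> {pathstart h}"
        using disj ph h(3) by (auto simp: pathstart_def)
    qed
    moreover have "path_image (reversepath g +++ h) \<subseteq> path_image g \<union> path_image h"
      using path_image_join_subset[of "reversepath g" h] by simp
    then have "path_image (reversepath g +++ h) \<subseteq> M" using g(2) h(2) W(5) by (meson Diff_subset Un_least subset_trans)
    moreover have "(reversepath g +++ h) (1 / 2) = g 0"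
      by (simp add: joinpaths_def reversepath_def)
    ultimately show False using not_inner[of "reversepath g +++ h" "1 / 2"] by simp
  qed
  with W(4) have sub: "W \<subseteq> g ` {0..<1}" by (rule order_trans)
  have "{0..<1} = insert 0 {0<..<1::real}" by auto
  then have eq: "g ` {0..<1} = insert x (g ` {0<..<1})" unfolding x_def by (metis image_insert)
  have "g ` {0..<1} = W \<union> g ` {0<..<1}" using sub W(3) unfolding eq by blast
  then show ?thesis using open_in W by (simp add: openin_Un)
qed

text \<open>
  A point inside some arc has an open interval as a neighbourhood.  Any other point is joined to a
  second point of \<open>M\<close> by an arc starting there, which without its far end is a half-open interval.
\<close>

lemma one_manifold_if_arc_interiors_open:
  fixes M :: "'a::euclidean_space set"
  assumes arcs: "arc_interiors_open M" and lpc: "locally path_connected M"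
    and conn: "path_connected M" and two: "p \<in> M" "q \<in> M" "p \<noteq> q"
  shows "one_manifold_with_boundary (top_of_set M)"
proof (rule one_manifold_with_boundary_top_of_set)
  fix x assume x: "x \<in> M"
  show "\<exists>U V. openin (top_of_set M) U \<and> x \<in> U \<and> openin (top_of_set {0::real..}) V \<and> U homeomorphic V"
  proof (cases "\<exists>g \<tau>. arc g \<and> path_image g \<subseteq> M \<and> 0 < \<tau> \<and> \<tau> < 1 \<and> g \<tau> = x")
    case True
    then obtain g \<tau> where g: "arc g" "path_image g \<subseteq> M" "0 < \<tau>" "\<tau> < 1" "g \<tau> = x" by blast
    have "openin (top_of_set M) (g ` {0<..<1})"
      using arcs g unfolding arc_interiors_open_def by blast
    moreover have "x \<in> g ` {0<..<1}" using g by auto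
    moreover have "openin (top_of_set {0::real..}) {0<..<1}"
      by (rule open_subset) auto
    moreover have "g ` {0<..<1} homeomorphic {0<..<1::real}"
      by (rule arc_image_homeomorphic[OF g(1)]) auto
    ultimately show ?thesis by blast
  next
    case False
    obtain y where "y \<in> M" "x \<noteq> y" using two by metis
    then obtain g where g: "arc g" "path_image g \<subseteq> M" "g 0 = x" "g 1 = y"
      using conn x unfolding path_connected_arcwise pathstart_def pathfinish_def by blast
    have "openin (top_of_set M) (g ` {0..<1})"
      by (rule arc_end_nbhd[OF arcs lpc g(1,2)]) (use False g in blast)
    moreover have "x \<in> g ` {0..<1}" using g by auto
    moreover have "openin (top_of_set {0::real..}) {0..<1}"
      unfolding openin_open by (intro exI[of _ "{..<1}"]) auto
    moreover have "g ` {0..<1} homeomorphic {0..<1::real}"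
      by (rule arc_image_homeomorphic[OF g(1)]) auto
    ultimately show ?thesis by blast
  qed
qed

section \<open>Curves of finite tangent-point energy\<close>

text \<open>
  Absolute continuity of the integral, in a form that avoids the measurability of \<open>F\<close>.  The
  integral of an arbitrary function is a supremum over simple functions below it, and a finite
  supremum is attained up to \<open>\<eta> / 2\<close> by a simple function \<open>f\<close> with a bound \<open>K\<close>.  Replacing \<open>f\<close>
  by the constant \<open>c\<close> on the interval gives a function that is still below \<open>F\<close>, so the
  replacement gains at most \<open>\<eta> / 2\<close>, while it removes at most \<open>K * (b - a)\<close>.
\<close>

lemma nn_integral_small_on_short_intervals:
  fixes F :: "real \<Rightarrow> ennreal" and \<eta> :: real
  assumes fin: "(\<integral>\<^sup>+t. F t \<partial>lborel) < \<infinity>" and "0 < \<eta>"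
  obtains h where "0 < h"
    "\<And>a b c. \<lbrakk>a \<le> b; b - a \<le> h; 0 \<le> c; AE t in lborel. t \<in> {a..b} \<longrightarrow> ennreal c \<le> F t\<rbrakk>
        \<Longrightarrow> c * (b - a) < \<eta>"
proof -
  let ?J = "\<integral>\<^sup>+t. F t \<partial>lborel"
  obtain f where f: "simple_function lborel f" "f \<le> F" "\<And>x. f x < top"
    and big: "?J \<le> integral\<^sup>S lborel f + ennreal (\<eta> / 2)"
  proof (cases "?J = 0")
    case True
    then show ?thesis by (intro that[of "\<lambda>_. 0"]) (auto simp: le_fun_def)
  next
    case False
    have "?J - ennreal (\<eta> / 2) < ?J"
      using fin False \<open>0 < \<eta>\<close> by (intro ennreal_between) (auto simp: zero_less_iff_neq_zero)
    then obtain f where f: "simple_function lborel f" "f \<le> F" "\<forall>x. f x < top"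
        and "?J - ennreal (\<eta> / 2) < integral\<^sup>S lborel f"
      using nn_integral_def_finite[of lborel F] by (auto simp: less_SUP_iff)
    then have "?J - ennreal (\<eta> / 2) \<le> integral\<^sup>S lborel f" by simp
    then have "?J \<le> integral\<^sup>S lborel f + ennreal (\<eta> / 2)"
      unfolding ennreal_minus_le_iff by (simp add: add.commute)
    then show ?thesis using f by (intro that[of f]) auto
  qed
  have fin_range: "finite (range f)"
    using simple_functionD(1)[OF f(1)] by simp
  define K where "K = enn2real (Max (range f))"
  have "Max (range f) \<in> range f" using fin_range by (intro Max_in) auto
  then have "Max (range f) < top" using f(3) by auto
  then have fK: "f t \<le> ennreal K" for t
    unfolding K_def using Max_ge[OF fin_range, of "f t"] by simp
  have "0 \<le> K" by (simp add: K_def)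
  have [measurable]: "f \<in> borel_measurable lborel" using f(1) by (rule borel_measurable_simple_function)
  have If: "integral\<^sup>S lborel f = (\<integral>\<^sup>+t. f t \<partial>lborel)"
    using f(1) by (simp add: nn_integral_eq_simple_integral)
  have Jf: "(\<integral>\<^sup>+t. f t \<partial>lborel) \<le> ?J" using f(2) by (intro nn_integral_mono) (auto simp: le_fun_def)
  define h where "h = \<eta> / (4 * (K + 1))"
  have "0 < h" using \<open>0 < \<eta>\<close> \<open>0 \<le> K\<close> by (simp add: h_def)
  moreover have "c * (b - a) < \<eta>"
    if ab: "a \<le> b" "b - a \<le> h" and "0 \<le> c"
      and ae: "AE t in lborel. t \<in> {a..b} \<longrightarrow> ennreal c \<le> F t" for a b c
  proof -
    let ?g = "\<lambda>t. ennreal c * indicator {a..b} t + f t * indicator (- {a..b}) t"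
    let ?R = "\<integral>\<^sup>+t. f t * indicator (- {a..b}) t \<partial>lborel"
    have "(\<integral>\<^sup>+t. f t \<partial>lborel) = (\<integral>\<^sup>+t. f t * indicator {a..b} t + f t * indicator (- {a..b}) t \<partial>lborel)"
      by (intro nn_integral_cong) (auto simp: indicator_def)
    also have "\<dots> = (\<integral>\<^sup>+t. f t * indicator {a..b} t \<partial>lborel) + ?R"
      by (rule nn_integral_add) auto
    also have "(\<integral>\<^sup>+t. f t * indicator {a..b} t \<partial>lborel) \<le> (\<integral>\<^sup>+t. ennreal K * indicator {a..b} t \<partial>lborel)"
      using fK by (intro nn_integral_mono mult_right_mono) auto
    also have "\<dots> = ennreal (K * (b - a))"
      using ab \<open>0 \<le> K\<close> by (simp add: nn_integral_cmult_indicator ennreal_mult)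
    finally have 1: "(\<integral>\<^sup>+t. f t \<partial>lborel) \<le> ennreal (K * (b - a)) + ?R" by (simp add: add_right_mono)
    have "ennreal (c * (b - a)) + ?R = (\<integral>\<^sup>+t. ?g t \<partial>lborel)"
      using ab \<open>0 \<le> c\<close> by (subst nn_integral_add) (auto simp: nn_integral_cmult_indicator ennreal_mult)
    also have "\<dots> \<le> ?J"
      using ae by (intro nn_integral_mono_AE, eventually_elim)
        (use f(2) in \<open>auto simp: indicator_def le_fun_def\<close>)
    also have "\<dots> \<le> ennreal (K * (b - a)) + ?R + ennreal (\<eta> / 2)"
      using big 1 unfolding If by (meson add_right_mono order_trans)
    finally have "?R + ennreal (c * (b - a)) \<le> ?R + ennreal (K * (b - a) + \<eta> / 2)"
      using ab \<open>0 \<le> K\<close> \<open>0 < \<eta>\<close> by (simp add: ennreal_plus ac_simps)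
    moreover have "?R < top"
    proof -
      have "?R \<le> (\<integral>\<^sup>+t. f t \<partial>lborel)" by (intro nn_integral_mono) (auto simp: indicator_def)
      then show ?thesis using Jf fin by (auto simp: less_top[symmetric] top_unique)
    qed
    ultimately have "ennreal (c * (b - a)) \<le> ennreal (K * (b - a) + \<eta> / 2)"
      unfolding ennreal_add_left_cancel_le by auto
    then have "c * (b - a) \<le> K * (b - a) + \<eta> / 2"
      using ab \<open>0 \<le> K\<close> \<open>0 < \<eta>\<close> by (subst (asm) ennreal_le_iff) auto
    also have "K * (b - a) \<le> (K + 1) * h" using ab \<open>0 \<le> K\<close> by (intro mult_mono) auto
    also have "(K + 1) * h = \<eta> / 4" using \<open>0 \<le> K\<close> by (simp add: h_def field_simps)
    finally show ?thesis using \<open>0 < \<eta>\<close> by linarith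
  qed
  ultimately show thesis by (rule that)
qed

lemma axis_deviation_le_infdist_tangent_line:
  assumes "has_unit_tangent_at \<Gamma> t"
  shows "axis_deviation (vector_derivative \<Gamma> (at t)) (p - \<Gamma> t) \<le> infdist p (tangent_line \<Gamma> t)"
proof -
  have "tangent_line \<Gamma> t \<noteq> {}" by (auto simp: tangent_line_def)
  moreover have "axis_deviation (vector_derivative \<Gamma> (at t)) (p - \<Gamma> t) \<le> dist p a"
    if "a \<in> tangent_line \<Gamma> t" for a
    using that assms axis_deviation_le_norm_diff
    by (auto simp: tangent_line_def has_unit_tangent_at_def dist_norm diff_diff_eq[symmetric])
  ultimately show ?thesis by (simp add: infdist_notempty cINF_greatest)
qed

text \<open>
  Off the tangent line by more than \<open>\<beta>\<close> at distance at most \<open>D\<close>, a point has a tangent-point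
  radius of at most \<open>D\<^sup>2 / (2 * \<beta>)\<close>.  As this bound is at most \<open>1\<close>, the exponent \<open>2\<close> is the worst
  among all \<open>q \<ge> 2\<close>.
\<close>

lemma energy_density_lower_bound:
  assumes tan: "has_unit_tangent_at \<Gamma> t" and "2 \<le> q"
    and "0 < \<beta>" "2 * \<beta> \<ge> D\<^sup>2"
    and near: "dist (\<Gamma> t) (\<Gamma> s) \<le> D"
    and far: "\<beta> < axis_deviation (vector_derivative \<Gamma> (at t)) (\<Gamma> s - \<Gamma> t)"
  shows "ennreal ((2 * \<beta> / D\<^sup>2)\<^sup>2) \<le> 1 / ennreal_powr (tangent_point_radius \<Gamma> t s) q"
proof -
  let ?v = "vector_derivative \<Gamma> (at t)" and ?d = "infdist (\<Gamma> s) (tangent_line \<Gamma> t)"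
  have d: "\<beta> < ?d" using far axis_deviation_le_infdist_tangent_line[OF tan, of "\<Gamma> s"] by linarith
  have ne: "\<Gamma> t \<noteq> \<Gamma> s" using far \<open>0 < \<beta>\<close> by (auto simp: axis_deviation_def)
  have np: "\<not> (\<exists>c. \<Gamma> s - \<Gamma> t = c *\<^sub>R ?v)"
  proof
    assume "\<exists>c. \<Gamma> s - \<Gamma> t = c *\<^sub>R ?v"
    then obtain c where "\<Gamma> s = \<Gamma> t + c *\<^sub>R ?v" by (metis add.commute diff_add_cancel)
    then have "\<Gamma> s \<in> tangent_line \<Gamma> t" by (auto simp: tangent_line_def)
    then show False using d \<open>0 < \<beta>\<close> by simp
  qed
  define r where "r = (dist (\<Gamma> t) (\<Gamma> s))\<^sup>2 / (2 * ?d)"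
  have "0 < dist (\<Gamma> t) (\<Gamma> s)" using ne by simp
  then have "0 < D" using near by linarith
  have "0 < r" using ne d \<open>0 < \<beta>\<close> by (simp add: r_def)
  have rD: "r \<le> D\<^sup>2 / (2 * \<beta>)"
    unfolding r_def using near d \<open>0 < \<beta>\<close> by (intro frac_le power_mono) auto
  also have "\<dots> \<le> 1" using assms by simp
  finally have r1: "r \<le> 1" .
  have "r powr q \<le> r powr 2" using \<open>0 < r\<close> r1 \<open>2 \<le> q\<close> by (intro powr_mono') auto
  also have "\<dots> = r\<^sup>2" using \<open>0 < r\<close> by simp
  also have "\<dots> \<le> (D\<^sup>2 / (2 * \<beta>))\<^sup>2" using rD \<open>0 < r\<close> by (intro power_mono) auto
  finally have le: "r powr q \<le> (D\<^sup>2 / (2 * \<beta>))\<^sup>2" .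
  have "(2 * \<beta> / D\<^sup>2)\<^sup>2 = 1 / (D\<^sup>2 / (2 * \<beta>))\<^sup>2" by (simp add: power_divide)
  also have "\<dots> \<le> 1 / r powr q"
    using le \<open>0 < r\<close> by (intro divide_left_mono mult_pos_pos) (auto intro: less_le_trans[OF _ le])
  finally have "ennreal ((2 * \<beta> / D\<^sup>2)\<^sup>2) \<le> ennreal (1 / r powr q)" by (rule ennreal_leI)
  also have "\<dots> = 1 / ennreal (r powr q)"
    using \<open>0 < r\<close> divide_ennreal[of 1 "r powr q"] by simp
  also have "\<dots> = 1 / ennreal_powr (tangent_point_radius \<Gamma> t s) q"
    using ne np \<open>0 < r\<close> by (simp add: tangent_point_radius_def ennreal_powr_def r_def)
  finally show ?thesis .
qed

text \<open>
  The energy only sees the parameters in one period, so the short intervals around a parameter have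
  to be kept inside it; they need not be centred.
\<close>

lemma subinterval_at_point:
  fixes u L h :: real
  assumes "u \<in> {0..L}" "0 < h" "h \<le> L"
  obtains a where "u \<in> {a..a+h}" "{a..a+h} \<subseteq> {0..L}"
proof (cases "u + h \<le> L")
  case True
  then show ?thesis using assms by (intro that[of u]) auto
next
  case False
  then show ?thesis using assms by (intro that[of "L - h"]) auto
qed

lemma closed_curve_range:
  assumes "0 < L" and per: "\<And>t. \<Gamma> (t + L) = \<Gamma> t"
  shows "range \<Gamma> = \<Gamma> ` {0..L::real}"
proof
  interpret periodic_fun_simple \<Gamma> L by standard (rule per)
  show "range \<Gamma> \<subseteq> \<Gamma> ` {0..L}"
  proof
    fix y assume "y \<in> range \<Gamma>"
    then obtain t where t: "y = \<Gamma> t" by blast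
    let ?u = "t - of_int \<lfloor>t / L\<rfloor> * L"
    have "\<Gamma> ?u = \<Gamma> t" by (rule minus_of_int)
    moreover have "?u \<in> {0..L}"
    proof -
      have "of_int \<lfloor>t / L\<rfloor> \<le> t / L" "t / L \<le> of_int \<lfloor>t / L\<rfloor> + 1" by linarith+
      then have "of_int \<lfloor>t / L\<rfloor> * L \<le> t" "t \<le> (of_int \<lfloor>t / L\<rfloor> + 1) * L"
        using \<open>0 < L\<close> by (simp_all only: pos_le_divide_eq pos_divide_le_eq)
      then show ?thesis by (simp add: algebra_simps)
    qed
    ultimately show "y \<in> \<Gamma> ` {0..L}" using t by (metis imageI)
  qed
qed auto

text \<open>
  Fix \<open>x\<close> in the image and a small scale \<open>d\<close>, and consider the tangent lines at the parameters \<open>t\<close> in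
  an interval of length \<open>\<epsilon> * d\<close> at a parameter of \<open>x\<close>.  If none of them served as an axis for the
  \<open>d\<close>-ball around \<open>x\<close>, then for each \<open>t\<close> there would be an interval of parameters \<open>s\<close>, again of
  length \<open>\<epsilon> * d\<close>, for which \<open>\<Gamma> s\<close> is within about \<open>d\<close> of \<open>x\<close> but has distance more than
  \<open>\<epsilon> * d\<close> from the line.  There the integrand is of order at least \<open>(\<epsilon> / d)\<^sup>2\<close>, so the energy coming
  from these \<open>t\<close> would be at least of order \<open>\<epsilon> ^ 4\<close>.  This bound does not depend on \<open>d\<close>, whereas
  the energy over short intervals of \<open>t\<close> tends to \<open>0\<close>.
\<close>

lemma finite_energy_imp_flat:
  fixes \<Gamma> :: "real \<Rightarrow> real ^ 'n"
  assumes "0 < L" and "2 \<le> q" and curve: "arclength_closed_curve L \<Gamma>"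
    and fin: "tangent_point_energy L q \<Gamma> < \<infinity>"
  obtains \<delta> where "0 < \<delta>" "flat_below_scale (range \<Gamma>) \<delta>"
proof -
  obtain C0 where C0: "C0-lipschitz_on UNIV \<Gamma>"
    and ae: "AE t in lborel. has_unit_tangent_at \<Gamma> t" and per: "\<And>t. \<Gamma> (t + L) = \<Gamma> t"
    using curve unfolding arclength_closed_curve_def by blast
  define C where "C = max C0 1"
  have "1 \<le> C" by (simp add: C_def)
  have lip: "norm (\<Gamma> s - \<Gamma> t) \<le> C * \<bar>s - t\<bar>" for s t
  proof -
    have "norm (\<Gamma> s - \<Gamma> t) \<le> C0 * \<bar>s - t\<bar>"
      using lipschitz_onD[OF C0, of s t] by (simp add: dist_norm)
    also have "\<dots> \<le> C * \<bar>s - t\<bar>" by (intro mult_right_mono) (auto simp: C_def)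
    finally show ?thesis .
  qed
  \<comment> \<open>Over a parameter interval of length \<open>\<epsilon> * d\<close> the curve moves by at most \<open>d / 192\<close>.  Three errors of
    this size (the centre, the chosen point, the deviation from the tangent line) add up to \<open>d / 64\<close>.\<close>
  define \<epsilon> where "\<epsilon> = 1 / (192 * C)"
  have \<epsilon>: "0 < \<epsilon>" "\<epsilon> \<le> 1" "C * \<epsilon> = 1 / 192" "\<epsilon> \<le> 1 / 192"
    using \<open>1 \<le> C\<close> by (auto simp: \<epsilon>_def field_simps)
  define F where "F t = (\<integral>\<^sup>+ s \<in> {0..L}. 1 / ennreal_powr (tangent_point_radius \<Gamma> t s) q \<partial>lborel)
      * indicator {t \<in> {0..L}. has_unit_tangent_at \<Gamma> t} t" for t
  have "(\<integral>\<^sup>+t. F t \<partial>lborel) < \<infinity>"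
    using fin unfolding tangent_point_energy_def F_def .
  moreover have "0 < 4 * \<epsilon> ^ 4 / 81" using \<epsilon> by simp
  ultimately obtain h where "0 < h" and h:
    "\<And>a b c. \<lbrakk>a \<le> b; b - a \<le> h; 0 \<le> c; AE t in lborel. t \<in> {a..b} \<longrightarrow> ennreal c \<le> F t\<rbrakk>
        \<Longrightarrow> c * (b - a) < 4 * \<epsilon> ^ 4 / 81"
    using nn_integral_small_on_short_intervals by blast
  \<comment> \<open>The first bound makes the estimate of the radius at most 1, the second makes room for intervals of
    length \<open>\<epsilon> * d\<close> in a period.\<close>
  define \<delta> where "\<delta> = Min {2 * \<epsilon> / 9, L, h}"
  have \<delta>: "0 < \<delta>" "\<delta> \<le> 2 * \<epsilon> / 9" "\<delta> \<le> L" "\<delta> \<le> h"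
    using \<epsilon> \<open>0 < L\<close> \<open>0 < h\<close> by (auto simp: \<delta>_def)
  have "flat_below_scale (range \<Gamma>) \<delta>"
    unfolding flat_below_scale_def
  proof (intro ballI allI impI, elim conjE)
    fix x d assume "x \<in> range \<Gamma>" and d: "0 < d" "d \<le> \<delta>"
    then obtain u where u: "u \<in> {0..L}" "x = \<Gamma> u"
      using closed_curve_range[of L \<Gamma>, OF \<open>0 < L\<close> per] by blast
    define k where "k = \<epsilon> * d"
    have Ck: "C * k = d / 192" using \<epsilon>(3) by (simp add: k_def mult.assoc[symmetric])
    have "k \<le> d" using \<epsilon> d by (simp add: k_def mult_left_le_one_le)
    moreover have "0 < k" using \<epsilon> d by (simp add: k_def)
    ultimately have k: "0 < k" "k \<le> L" "k \<le> h" using d \<delta> by linarith+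
    have close: "norm (\<Gamma> s - \<Gamma> t) \<le> d / 192" if "\<bar>s - t\<bar> \<le> k" for s t
      using lip[of s t] mult_left_mono[OF that, of C] \<open>1 \<le> C\<close> Ck by linarith
    obtain a where a: "u \<in> {a..a+k}" "{a..a+k} \<subseteq> {0..L}"
      using subinterval_at_point[OF u(1) k(1,2)] .
    let ?e = "\<lambda>t. vector_derivative \<Gamma> (at t)"
    let ?good = "\<lambda>t. \<forall>w \<in> range \<Gamma> \<inter> cball x d. \<exists>s. norm (\<Gamma> s - w) \<le> d / 192 \<and>
        axis_deviation (?e t) (\<Gamma> s - \<Gamma> t) \<le> k"
    have "\<exists>t \<in> {a..a+k}. has_unit_tangent_at \<Gamma> t \<and> ?good t"
    proof (rule ccontr)
      assume neg: "\<not> ?thesis"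
      \<comment> \<open>The integrand at distance at most \<open>3 * d\<close> and deviation \<open>k\<close>, times the length \<open>k\<close> of the
        interval of parameters \<open>s\<close>.\<close>
      let ?c = "(2 * k / (3 * d)\<^sup>2)\<^sup>2 * k"
      have "ennreal ?c \<le> F t" if t: "t \<in> {a..a+k}" and tan: "has_unit_tangent_at \<Gamma> t" for t
      proof -
        have "\<not> ?good t" using neg t tan by blast
        then obtain w where w0: "w \<in> range \<Gamma> \<inter> cball x d"
          and bad0: "\<And>s. \<not> (norm (\<Gamma> s - w) \<le> d / 192 \<and> axis_deviation (?e t) (\<Gamma> s - \<Gamma> t) \<le> k)"
          by blast
        have w: "w \<in> range \<Gamma>" "dist x w \<le> d" using w0 by auto
        have bad: "k < axis_deviation (?e t) (\<Gamma> s - \<Gamma> t)" if "norm (\<Gamma> s - w) \<le> d / 192" for s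
          using bad0[of s] that by linarith
        obtain v where v: "v \<in> {0..L}" "w = \<Gamma> v"
          using w(1) closed_curve_range[of L \<Gamma>, OF \<open>0 < L\<close> per] by blast
        obtain b where b: "v \<in> {b..b+k}" "{b..b+k} \<subseteq> {0..L}"
          using subinterval_at_point[OF v(1) k(1,2)] .
        have "ennreal ((2 * k / (3 * d)\<^sup>2)\<^sup>2) \<le> 1 / ennreal_powr (tangent_point_radius \<Gamma> t s) q"
          if s: "s \<in> {b..b+k}" for s
        proof (rule energy_density_lower_bound[OF tan \<open>2 \<le> q\<close> k(1)])
          have sw: "norm (\<Gamma> s - w) \<le> d / 192" unfolding v(2) using s b by (intro close) auto
          then show "k < axis_deviation (?e t) (\<Gamma> s - \<Gamma> t)" by (rule bad)
          have tx: "norm (\<Gamma> t - x) \<le> d / 192" unfolding u(2) using t a by (intro close) auto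
          have "dist (\<Gamma> t) (\<Gamma> s) \<le> norm (\<Gamma> t - x) + dist x w + norm (\<Gamma> s - w)"
            unfolding dist_norm by norm
          then show "dist (\<Gamma> t) (\<Gamma> s) \<le> 3 * d" using sw tx w(2) d by linarith
          have "9 * d \<le> 2 * \<epsilon>" using d \<delta> by simp
          then have "9 * d * d \<le> 2 * \<epsilon> * d" using d by (intro mult_right_mono) auto
          then show "(3 * d)\<^sup>2 \<le> 2 * k" by (simp add: k_def power2_eq_square)
        qed
        then have "(\<integral>\<^sup>+s. ennreal ((2 * k / (3 * d)\<^sup>2)\<^sup>2) * indicator {b..b+k} s \<partial>lborel)
            \<le> (\<integral>\<^sup>+ s \<in> {0..L}. 1 / ennreal_powr (tangent_point_radius \<Gamma> t s) q \<partial>lborel)"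
          using b(2) by (intro nn_integral_mono) (auto simp: indicator_def)
        also have "\<dots> = F t" using t a tan by (auto simp: F_def indicator_def)
        finally show ?thesis
          using k by (simp add: nn_integral_cmult_indicator ennreal_mult)
      qed
      with ae have "AE t in lborel. t \<in> {a..a+k} \<longrightarrow> ennreal ?c \<le> F t"
        by (auto elim: eventually_mono)
      then have "?c * (a + k - a) < 4 * \<epsilon> ^ 4 / 81" using k by (intro h) auto
      moreover have "?c * (a + k - a) = 4 * \<epsilon> ^ 4 / 81"
        using d by (simp add: k_def power2_eq_square power4_eq_xxxx field_simps)
      ultimately show False by simp
    qed
    then obtain t where t: "t \<in> {a..a+k}" "has_unit_tangent_at \<Gamma> t" and good: "?good t" by blast
    have e: "norm (?e t) = 1" using t by (simp add: has_unit_tangent_at_def)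
    have tx: "norm (\<Gamma> t - x) \<le> d / 192" unfolding u(2) using t a by (intro close) auto
    have "flat_at (range \<Gamma>) x d (?e t)"
      unfolding flat_at_def
    proof (intro conjI ballI)
      fix w assume "w \<in> range \<Gamma> \<inter> cball x d"
      then obtain s where s: "norm (\<Gamma> s - w) \<le> d / 192"
          "axis_deviation (?e t) (\<Gamma> s - \<Gamma> t) \<le> k" using good by blast
      have "w - x = (\<Gamma> s - \<Gamma> t) + ((w - \<Gamma> s) + (\<Gamma> t - x))" by simp
      then have "axis_deviation (?e t) (w - x) \<le> axis_deviation (?e t) (\<Gamma> s - \<Gamma> t)
          + (axis_deviation (?e t) (w - \<Gamma> s) + axis_deviation (?e t) (\<Gamma> t - x))"
        using axis_deviation_add[of "?e t" "\<Gamma> s - \<Gamma> t" "(w - \<Gamma> s) + (\<Gamma> t - x)"]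
          axis_deviation_add[of "?e t" "w - \<Gamma> s" "\<Gamma> t - x"] by simp
      also have "\<dots> \<le> k + (norm (w - \<Gamma> s) + norm (\<Gamma> t - x))"
        using s(2) axis_deviation_le_norm[OF e] by (intro add_mono) auto
      also have "\<dots> \<le> d / 64"
      proof -
        have "k \<le> d / 192" using \<epsilon>(4) d by (simp add: k_def mult.commute)
        then show ?thesis using s(1) tx by (simp add: norm_minus_commute)
      qed
      finally show "axis_deviation (?e t) (w - x) \<le> d / 64" .
    qed (rule e)
    then show "\<exists>e. flat_at (range \<Gamma>) x d e" by blast
  qed
  with \<delta>(1) show thesis by (rule that)
qed

theorem theorem1p1:
  fixes \<Gamma> :: "real \<Rightarrow> real ^ 'n" and L q :: real
  assumes "L > 0" and "q \<ge> 2"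
    and "arclength_closed_curve L \<Gamma>"
    and "tangent_point_energy L q \<Gamma> < \<infinity>"
  shows "embedded_one_manifold_with_boundary (range \<Gamma>)"
  unfolding embedded_one_manifold_with_boundary_def
proof -
  have per: "\<Gamma> (t + L) = \<Gamma> t" for t
    using assms(3) by (simp add: arclength_closed_curve_def)
  obtain C where lip: "C-lipschitz_on UNIV \<Gamma>"
    and ae: "AE t in lborel. has_unit_tangent_at \<Gamma> t"
    using assms(3) by (auto simp: arclength_closed_curve_def)
  have cont: "continuous_on {0..L} \<Gamma>"
    using lipschitz_on_continuous_on[OF lip] by (rule continuous_on_subset) simp
  have M: "range \<Gamma> = \<Gamma> ` {0..L}"
    using closed_curve_range[of L \<Gamma>, OF assms(1) per] .
  have lpc: "locally path_connected (range \<Gamma>)"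
    unfolding M by (rule locally_path_connected_compact_image[OF cont])
  have pc: "path_connected (range \<Gamma>)"
    unfolding M by (intro path_connected_continuous_image[OF cont]) (simp add: convex_imp_path_connected)
  \<comment> \<open>A single point is not a one-manifold; a curve with a unit tangent somewhere is not constant.\<close>
  obtain t where t: "has_unit_tangent_at \<Gamma> t"
  proof (rule ccontr)
    assume "\<not> thesis"
    then have "AE t in (lborel :: real measure). False"
      using ae that by (auto elim: eventually_mono)
    then show False by (simp add: eventually_False ae_filter_eq_bot_iff)
  qed
  have "\<exists>s. \<Gamma> s \<noteq> \<Gamma> t"
  proof (rule ccontr)
    assume "\<not> ?thesis"
    then have "\<Gamma> = (\<lambda>_. \<Gamma> t)" by auto
    then have "vector_derivative \<Gamma> (at t) = 0" by (metis vector_derivative_const_at)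
    with t show False by (simp add: has_unit_tangent_at_def)
  qed
  then obtain s where "\<Gamma> s \<noteq> \<Gamma> t" ..
  moreover obtain \<delta> where "0 < \<delta>" "flat_below_scale (range \<Gamma>) \<delta>"
    using finite_energy_imp_flat[OF assms] .
  ultimately show "one_manifold_with_boundary (top_of_set (range \<Gamma>))"
    by (intro one_manifold_if_arc_interiors_open[OF arc_interiors_openI lpc pc rangeI rangeI])
qed

end
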